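(* Let $L\ge 2$ and $n\ge 1$ be integers and let $f_0(w),\dots,f_{L-1}(w)\in\mathbb{C}[\![w]\!]$ be formal power series with $f_0(0)\neq 0$. Let $Q^{(i)}_j(w)$ and $P^{(j)}_i(w)$ $(0\le i,j\le L-1)$ be polynomials satisfying the two systems of approximation conditions (Hermite–Padé and simultaneous Padé) given in the context, and let $\widetilde{\boldsymbol Q}^{(i)}$ (row vectors) and $\widetilde{\boldsymbol P}^{(j)}$ (column vectors) be the associated vectors of polynomials. Then $$\begin{bmatrix}\widetilde{\boldsymbol Q}^{(0)}\\ \vdots\\ \widetilde{\boldsymbol Q}^{(L-1)}\end{bmatrix}\left[\widetilde{\boldsymbol P}^{(0)},\dots,\widetilde{\boldsymbol P}^{(L-1)}\right]=w^{nL}\cdot D$$ for some diagonal constant matrix $D\in\mathbb{C}^{L\times L}$.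
   Context: $\delta_{i,j}$ is the Kronecker delta. $O(w^k)$ denotes a formal power series in $w$ divisible by $w^k$. Hermite–Padé approximation: for each $0\le i\le L-1$, $(Q^{(i)}_j)_{0\le j\le L-1}$ are polynomials in $w$ with $\deg Q^{(i)}_j\le n-1+\delta_{i,j}$ and $$Q_0^{(i)}f_0+\cdots+Q_i^{(i)}f_i+wQ_{i+1}^{(i)}f_{i+1}+\cdots+wQ_{L-1}^{(i)}f_{L-1}=O(w^{nL}).$$ Put $\widetilde{\boldsymbol Q}^{(i)}=\left(Q_0^{(i)},\dots,Q_i^{(i)},wQ_{i+1}^{(i)},\dots,wQ_{L-1}^{(i)}\right)$. Simultaneous Padé approximation: for each $0\le j\le L-1$, $(P^{(j)}_i)_{0\le i\le L-1}$ are polynomials in $w$ with $\deg P_i^{(j)}\le n(L-1)-1+\delta_{i,j}$ such that: if $j=0$, $f_0P_i^{(0)}-f_iP_0^{(0)}=O(w^{nL})$ for $1\le i\le L-1$; if $1\le j\le L-1$, $f_0P_i^{(j)}-f_iP_0^{(j)}=O(w^{nL})$ for $1\le i\le j-1$ and $f_0P_i^{(j)}-f_i\,wP_0^{(j)}=O(w^{nL})$ for $j\le i\le L-1$. Put $\widetilde{\boldsymbol P}^{(j)}={}^{\mathrm T}\left(wP_0^{(j)},\dots,wP_{j-1}^{(j)},P_j^{(j)},\dots,P_{L-1}^{(j)}\right)$. *)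

theory Defs
  imports
    Complex_Main
    "HOL-Computational_Algebra.Polynomial_FPS"
    "Jordan_Normal_Form.Matrix"
begin

definition fps_bigo_X :: "nat \<Rightarrow> complex fps \<Rightarrow> bool" where
  "fps_bigo_X k g \<longleftrightarrow> fps_X ^ k dvd g"

text \<open>
  Indexing: \<open>Q i j\<close> is the polynomial with upper index \<open>i\<close> and lower index \<open>j\<close>, whereas \<open>P j i\<close>
  has upper index \<open>j\<close> and lower index \<open>i\<close>; the upper index always comes first. Only the indices
  below \<open>L\<close> are relevant. The degree bounds use subtraction of natural numbers, which does not
  truncate for \<open>n \<ge> 1\<close> and \<open>L \<ge> 2\<close>.
\<close>

definition hermite_pade ::
  "nat \<Rightarrow> nat \<Rightarrow> (nat \<Rightarrow> complex fps) \<Rightarrow> (nat \<Rightarrow> nat \<Rightarrow> complex poly) \<Rightarrow> bool" where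
  "hermite_pade L n f Q \<longleftrightarrow>
     (\<forall>i<L.
        (\<forall>j<L. degree (Q i j) \<le> n - 1 + of_bool (i = j)) \<and>
        fps_bigo_X (n * L)
          ((\<Sum>j\<in>{0..i}. fps_of_poly (Q i j) * f j) +
           (\<Sum>j\<in>{i<..<L}. fps_X * fps_of_poly (Q i j) * f j)))"

definition simultaneous_pade ::
  "nat \<Rightarrow> nat \<Rightarrow> (nat \<Rightarrow> complex fps) \<Rightarrow> (nat \<Rightarrow> nat \<Rightarrow> complex poly) \<Rightarrow> bool" where
  "simultaneous_pade L n f P \<longleftrightarrow>
     (\<forall>j<L. \<forall>i<L. degree (P j i) \<le> n * (L - 1) - 1 + of_bool (i = j)) \<and>
     (\<forall>i\<in>{1..<L}.
        fps_bigo_X (n * L) (f 0 * fps_of_poly (P 0 i) - f i * fps_of_poly (P 0 0))) \<and>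
     (\<forall>j\<in>{1..<L}.
        (\<forall>i\<in>{1..<j}.
           fps_bigo_X (n * L) (f 0 * fps_of_poly (P j i) - f i * fps_of_poly (P j 0))) \<and>
        (\<forall>i\<in>{j..<L}.
           fps_bigo_X (n * L) (f 0 * fps_of_poly (P j i) - f i * (fps_X * fps_of_poly (P j 0)))))"

abbreviation poly_w :: "complex poly" where
  "poly_w \<equiv> monom 1 1"

definition Q_tilde :: "nat \<Rightarrow> (nat \<Rightarrow> nat \<Rightarrow> complex poly) \<Rightarrow> nat \<Rightarrow> complex poly vec" where
  "Q_tilde L Q i = vec L (\<lambda>j. if j \<le> i then Q i j else poly_w * Q i j)"

definition P_tilde :: "nat \<Rightarrow> (nat \<Rightarrow> nat \<Rightarrow> complex poly) \<Rightarrow> nat \<Rightarrow> complex poly vec" where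
  "P_tilde L P j = vec L (\<lambda>i. if i < j then poly_w * P j i else P j i)"

end

theory Submission
  imports Defs
begin

text \<open>
  Modulo \<open>w\<^bsup>nL\<^esup>\<close>, the vector \<open>f\<^sub>0 P~\<close> is a multiple of \<open>(f\<^sub>0, \<dots>, f\<^sub>L\<^sub>-\<^sub>1)\<close>,
  which \<open>Q~\<close> annihilates; since \<open>f\<^sub>0\<close> is a unit, \<open>w\<^bsup>nL\<^esup>\<close> divides every entry of the product.
  The degree of an entry is at most \<open>nL\<close>, and less than \<open>nL\<close> below the diagonal. Above the
  diagonal every summand of an entry contains an explicit factor \<open>w\<close>, and the same argument applied
  after cancelling it shows that even \<open>w\<^bsup>nL+1\<^esup>\<close> divides the entry.
\<close>

text \<open>Multiplied by the unit \<open>f0\<close>, the sum of the \<open>t k\<close> is congruent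
  to \<open>r\<close> times the annihilated sum. The terms \<open>t k\<close> are arbitrary rather
  than products with \<open>q k\<close>, so that summands with a factor w removed are covered
  too.\<close>

lemma fps_X_power_dvd_sum_of_cong:
  fixes f0 r :: "complex fps" and q f t :: "'a \<Rightarrow> complex fps"
  assumes "fps_nth f0 0 \<noteq> 0"
    and q: "fps_X ^ m dvd (\<Sum>k\<in>A. q k * f k)"
    and t: "\<And>k. k \<in> A \<Longrightarrow> fps_X ^ m dvd f0 * t k - q k * f k * r"
  shows "fps_X ^ m dvd (\<Sum>k\<in>A. t k)"
proof -
  have "fps_X ^ m dvd (\<Sum>k\<in>A. f0 * t k - q k * f k * r) + (\<Sum>k\<in>A. q k * f k) * r"
    by (rule dvd_add[OF dvd_sum[OF t] dvd_mult2[OF q]])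
  also have "\<dots> = f0 * (\<Sum>k\<in>A. t k)"
    by (simp add: sum_subtractf sum_distrib_left sum_distrib_right)
  finally have "fps_X ^ m dvd f0 * (\<Sum>k\<in>A. t k)" .
  moreover have "f0 dvd 1"
    using assms(1) by simp
  ultimately show ?thesis
    by (simp only: dvd_mult_unit_iff')
qed

lemma coeff_eq_0_of_fps_X_power_dvd:
  assumes "fps_X ^ m dvd fps_of_poly p" and "k < m"
  shows "coeff p k = 0"
proof -
  obtain g where g: "fps_of_poly p = fps_X ^ m * g"
    using assms(1) by (rule dvdE)
  have "coeff p k = fps_nth (fps_of_poly p) k"
    by simp
  also have "\<dots> = 0"
    unfolding g using assms(2) by (simp only: fps_X_power_mult_nth if_True)
  finally show ?thesis .
qed

lemma fps_of_poly_w: "fps_of_poly poly_w = fps_X"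
  by (simp add: fps_of_poly_monom)

text \<open>The simplifier turns the exponent \<open>1\<close> into \<open>Suc 0\<close>, so the
  rewrite rule has to match that form.\<close>

lemmas fps_of_poly_w' [simp] = fps_of_poly_w [unfolded One_nat_def]

text \<open>The extra degree comes from the Kronecker delta at k = i and from the factor w at k > i;
  a single indicator records both. The bound for \<open>P_tilde\<close> arises in the same
  way.\<close>

lemma degree_Q_tilde_le:
  assumes "hermite_pade L n f Q" and "n \<ge> 1" and "i < L" and "k < L"
  shows "degree (Q_tilde L Q i $ k) \<le> n - 1 + of_bool (i \<le> k)"
proof -
  have "degree (Q i k) \<le> n - 1 + of_bool (i = k)"
    using assms by (simp add: hermite_pade_def)
  moreover have "degree (poly_w * Q i k) \<le> 1 + degree (Q i k)"
    using degree_mult_le[of poly_w "Q i k"] by (simp add: degree_monom_eq)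
  ultimately show ?thesis
    using assms by (auto simp: Q_tilde_def)
qed

lemma degree_P_tilde_le:
  assumes "simultaneous_pade L n f P" and "j < L" and "k < L"
  shows "degree (P_tilde L P j $ k) \<le> n * (L - 1) - 1 + of_bool (k \<le> j)"
proof -
  have "degree (P j k) \<le> n * (L - 1) - 1 + of_bool (k = j)"
    using assms by (simp add: simultaneous_pade_def)
  moreover have "degree (poly_w * P j k) \<le> 1 + degree (P j k)"
    using degree_mult_le[of poly_w "P j k"] by (simp add: degree_monom_eq)
  ultimately show ?thesis
    using assms by (auto simp: P_tilde_def)
qed

lemma fps_X_power_dvd_Q_tilde_sum:
  assumes "hermite_pade L n f Q" and "i < L"
  shows "fps_X ^ (n * L) dvd (\<Sum>k<L. fps_of_poly (Q_tilde L Q i $ k) * f k)"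
proof -
  have split: "{..<L} = {0..i} \<union> {i<..<L}"
    using assms(2) by auto
  have "(\<Sum>k<L. fps_of_poly (Q_tilde L Q i $ k) * f k)
      = (\<Sum>k\<in>{0..i}. fps_of_poly (Q_tilde L Q i $ k) * f k)
        + (\<Sum>k\<in>{i<..<L}. fps_of_poly (Q_tilde L Q i $ k) * f k)"
    unfolding split by (rule sum.union_disjoint) auto
  also have "\<dots> = (\<Sum>k\<in>{0..i}. fps_of_poly (Q i k) * f k)
      + (\<Sum>k\<in>{i<..<L}. fps_X * fps_of_poly (Q i k) * f k)"
    using assms(2) by (intro arg_cong2[where f = "(+)"] sum.cong) (auto simp: Q_tilde_def fps_of_poly_mult)
  finally show ?thesis
    using assms by (simp add: hermite_pade_def fps_bigo_X_def)
qed

lemma fps_X_power_dvd_P_less: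
  assumes "simultaneous_pade L n f P" and "j < L" and "k < j"
  shows "fps_X ^ (n * L) dvd f 0 * fps_of_poly (P j k) - f k * fps_of_poly (P j 0)"
  \<comment> \<open>The Pade conditions start at index 1; at index 0 the difference vanishes
    identically.\<close>
  using assms by (cases "k = 0") (auto simp: simultaneous_pade_def fps_bigo_X_def)

lemma fps_X_power_dvd_P_ge:
  assumes "simultaneous_pade L n f P" and "1 \<le> j" and "j \<le> k" and "k < L"
  shows "fps_X ^ (n * L) dvd f 0 * fps_of_poly (P j k) - f k * (fps_X * fps_of_poly (P j 0))"
  using assms by (auto simp: simultaneous_pade_def fps_bigo_X_def)

text \<open>Entry 0 of \<open>P_tilde\<close> is w times \<open>P j 0\<close> for j > 0 and
  \<open>P 0 0\<close> for j = 0. With it as multiplier, the different kinds of simultaneous Pade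
  conditions become one proportionality to f.\<close>

lemma fps_X_power_dvd_P_tilde:
  assumes "simultaneous_pade L n f P" and "j < L" and "k < L"
  shows "fps_X ^ (n * L) dvd
    f 0 * fps_of_poly (P_tilde L P j $ k) - f k * fps_of_poly (P_tilde L P j $ 0)"
proof (cases "j = 0")
  case True
  then show ?thesis
    using assms by (cases "k = 0") (auto simp: simultaneous_pade_def fps_bigo_X_def P_tilde_def)
next
  case False
  show ?thesis
  proof (cases "k < j")
    case True
    then have "f 0 * fps_of_poly (P_tilde L P j $ k) - f k * fps_of_poly (P_tilde L P j $ 0)
        = fps_X * (f 0 * fps_of_poly (P j k) - f k * fps_of_poly (P j 0))"
      using assms False by (simp add: P_tilde_def fps_of_poly_mult algebra_simps)
    then show ?thesis
      using fps_X_power_dvd_P_less[OF assms(1,2) True] by (simp only: dvd_mult)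
  next
    case ge: False
    then show ?thesis
      using fps_X_power_dvd_P_ge[OF assms(1), of j k] assms False
      by (simp add: P_tilde_def fps_of_poly_mult)
  qed
qed

lemma fps_X_power_dvd_scalar_prod:
  assumes "fps_nth (f 0) 0 \<noteq> 0" and "hermite_pade L n f Q" and "simultaneous_pade L n f P"
    and "i < L" and "j < L"
  shows "fps_X ^ (n * L) dvd fps_of_poly (\<Sum>k<L. Q_tilde L Q i $ k * P_tilde L P j $ k)"
proof -
  have "fps_X ^ (n * L) dvd
    (\<Sum>k<L. fps_of_poly (Q_tilde L Q i $ k) * fps_of_poly (P_tilde L P j $ k))"
  proof (rule fps_X_power_dvd_sum_of_cong[OF assms(1) fps_X_power_dvd_Q_tilde_sum[OF assms(2,4)]])
    fix k assume "k \<in> {..<L}"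
    then have "fps_X ^ (n * L) dvd fps_of_poly (Q_tilde L Q i $ k) *
        (f 0 * fps_of_poly (P_tilde L P j $ k) - f k * fps_of_poly (P_tilde L P j $ 0))"
      using fps_X_power_dvd_P_tilde[OF assms(3,5)] by (intro dvd_mult) simp
    then show "fps_X ^ (n * L) dvd
        f 0 * (fps_of_poly (Q_tilde L Q i $ k) * fps_of_poly (P_tilde L P j $ k))
        - fps_of_poly (Q_tilde L Q i $ k) * f k * fps_of_poly (P_tilde L P j $ 0)"
      by (simp add: algebra_simps)
  qed
  then show ?thesis
    by (simp add: fps_of_poly_sum fps_of_poly_mult)
qed

text \<open>Since i < j, each index k satisfies k < j or k > i, so \<open>P_tilde\<close> or
  \<open>Q_tilde\<close> contributes a factor w to the summand.\<close>

lemma fps_X_power_Suc_dvd_scalar_prod: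
  assumes "fps_nth (f 0) 0 \<noteq> 0" and "hermite_pade L n f Q" and "simultaneous_pade L n f P"
    and "i < j" and "j < L"
  shows "fps_X ^ Suc (n * L) dvd fps_of_poly (\<Sum>k<L. Q_tilde L Q i $ k * P_tilde L P j $ k)"
proof -
  \<comment> \<open>The summand with exactly one w removed: from the \<open>P_tilde\<close> entry if
    k < j, otherwise from the \<open>Q_tilde\<close> entry. The common multiplier is then
    \<open>P j 0\<close> for every k.\<close>
  define t where "t k = (if k < j then Q_tilde L Q i $ k else Q i k) * P j k" for k
  have iL: "i < L"
    using assms by simp
  have "fps_X ^ (n * L) dvd (\<Sum>k<L. fps_of_poly (t k))"
  proof (rule fps_X_power_dvd_sum_of_cong[OF assms(1) fps_X_power_dvd_Q_tilde_sum[OF assms(2) iL]])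
    fix k assume k: "k \<in> {..<L}"
    show "fps_X ^ (n * L) dvd f 0 * fps_of_poly (t k)
        - fps_of_poly (Q_tilde L Q i $ k) * f k * fps_of_poly (P j 0)"
    proof (cases "k < j")
      case True
      then have "f 0 * fps_of_poly (t k)
          - fps_of_poly (Q_tilde L Q i $ k) * f k * fps_of_poly (P j 0)
          = fps_of_poly (Q_tilde L Q i $ k) *
            (f 0 * fps_of_poly (P j k) - f k * fps_of_poly (P j 0))"
        by (simp add: t_def fps_of_poly_mult algebra_simps)
      then show ?thesis
        using fps_X_power_dvd_P_less[OF assms(3,5) True] by (simp only: dvd_mult)
    next
      case False
      \<comment> \<open>Here k \<ge> j > i, so the \<open>Q_tilde\<close> entry is w times
        \<open>Q i k\<close>, and this w moves onto \<open>P j 0\<close> to match the Pade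
        condition.\<close>
      then have "f 0 * fps_of_poly (t k)
          - fps_of_poly (Q_tilde L Q i $ k) * f k * fps_of_poly (P j 0)
          = fps_of_poly (Q i k) *
            (f 0 * fps_of_poly (P j k) - f k * (fps_X * fps_of_poly (P j 0)))"
        using assms(4) k by (simp add: t_def Q_tilde_def fps_of_poly_mult algebra_simps)
      moreover have "1 \<le> j" "j \<le> k" "k < L"
        using False assms(4) k by auto
      ultimately show ?thesis
        using fps_X_power_dvd_P_ge[OF assms(3)] by (simp only: dvd_mult)
    qed
  qed
  then have "fps_X * fps_X ^ (n * L) dvd fps_X * (\<Sum>k<L. fps_of_poly (t k))"
    by (rule mult_dvd_mono[OF dvd_refl])
  also have "\<dots> = fps_of_poly (\<Sum>k<L. poly_w * t k)"
    by (simp only: sum_distrib_left fps_of_poly_sum fps_of_poly_mult fps_of_poly_w)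
  also have "(\<Sum>k<L. poly_w * t k) = (\<Sum>k<L. Q_tilde L Q i $ k * P_tilde L P j $ k)"
    using assms(4) by (intro sum.cong) (auto simp: t_def Q_tilde_def P_tilde_def algebra_simps)
  finally show ?thesis
    by simp
qed

text \<open>The two degree bounds add up to nL - 2 plus the indicators of i \<le> k and k \<le> j,
  which cannot both be 1 when j < i.\<close>

lemma degree_scalar_prod_le:
  assumes "L \<ge> 2" and "n \<ge> 1" and "hermite_pade L n f Q" and "simultaneous_pade L n f P"
    and "i < L" and "j < L"
  shows "degree (\<Sum>k<L. Q_tilde L Q i $ k * P_tilde L P j $ k) \<le> n * L - of_bool (j < i)"
proof (rule degree_sum_le)
  fix k assume "k \<in> {..<L}"
  then have k: "k < L"
    by simp
  have "degree (Q_tilde L Q i $ k * P_tilde L P j $ k)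
      \<le> (n - 1 + of_bool (i \<le> k)) + (n * (L - 1) - 1 + of_bool (k \<le> j))"
    using degree_mult_le degree_Q_tilde_le[OF assms(3,2,5) k] degree_P_tilde_le[OF assms(4,6) k]
    by (meson add_mono order_trans)
  also have "\<dots> \<le> n * L - of_bool (j < i)"
  proof -
    \<comment> \<open>This and the next fact make the estimate linear in n and n(L - 1), both
      positive, so no subtraction truncates.\<close>
    have "n * L = n + n * (L - 1)"
      using assms(1) by (cases L) auto
    moreover have "n * (L - 1) \<ge> 1"
      using assms(1,2) by simp
    ultimately show ?thesis
      using assms(2) by (auto simp: of_bool_def)
  qed
  finally show "degree (Q_tilde L Q i $ k * P_tilde L P j $ k) \<le> n * L - of_bool (j < i)" .
qed simp

theorem theorem1p3:
  fixes L n :: nat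
    and f :: "nat \<Rightarrow> complex fps"
    and Q P :: "nat \<Rightarrow> nat \<Rightarrow> complex poly"
  assumes "L \<ge> 2" and "n \<ge> 1"
    and "fps_nth (f 0) 0 \<noteq> 0"
    and "hermite_pade L n f Q"
    and "simultaneous_pade L n f P"
  shows "\<exists>D :: complex mat. D \<in> carrier_mat L L \<and> diagonal_mat D \<and>
           mat_of_rows L (map (Q_tilde L Q) [0..<L]) * mat_of_cols L (map (P_tilde L P) [0..<L])
             = poly_w ^ (n * L) \<cdot>\<^sub>m map_mat (\<lambda>c. [:c:]) D"
proof -
  define S where "S i j = (\<Sum>k<L. Q_tilde L Q i $ k * P_tilde L P j $ k)" for i j
  define D where "D = mat L L (\<lambda>(i, j). coeff (S i j) (n * L))"
  \<comment> \<open>Divisibility by w to the nL kills the lower coefficients and the degree bound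
    the higher ones.\<close>
  have S: "S i j = monom (coeff (S i j) (n * L)) (n * L)" if "i < L" "j < L" for i j
  proof (rule poly_eqI)
    fix m
    have "coeff (S i j) m = 0" if "m < n * L"
      using fps_X_power_dvd_scalar_prod[OF assms(3-5) \<open>i < L\<close> \<open>j < L\<close>] that
      unfolding S_def by (rule coeff_eq_0_of_fps_X_power_dvd)
    moreover have "coeff (S i j) m = 0" if "m > n * L"
      using degree_scalar_prod_le[OF assms(1,2,4,5) \<open>i < L\<close> \<open>j < L\<close>] that
      unfolding S_def by (intro coeff_eq_0) simp
    ultimately show "coeff (S i j) m = coeff (monom (coeff (S i j) (n * L)) (n * L)) m"
      by (cases m "n * L" rule: linorder_cases) auto
  qed
  have off_diag: "coeff (S i j) (n * L) = 0" if "i < L" "j < L" "i \<noteq> j" for i j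
  proof (cases "i < j")
    case True
    show ?thesis
      using fps_X_power_Suc_dvd_scalar_prod[OF assms(3-5) True \<open>j < L\<close>]
      unfolding S_def by (rule coeff_eq_0_of_fps_X_power_dvd) simp
  next
    case False
    \<comment> \<open>Now j < i, so the bound is nL - 1, which is strictly smaller because nL >
      0.\<close>
    then have "degree (S i j) < n * L"
      using degree_scalar_prod_le[OF assms(1,2,4,5) that(1,2)] that assms(1,2)
      by (simp add: S_def le_less_trans)
    then show ?thesis
      by (rule coeff_eq_0)
  qed
  have "mat_of_rows L (map (Q_tilde L Q) [0..<L]) * mat_of_cols L (map (P_tilde L P) [0..<L])
      = poly_w ^ (n * L) \<cdot>\<^sub>m map_mat (\<lambda>c. [:c:]) D"
  proof (rule eq_matI)
    fix i j
    assume "i < dim_row (poly_w ^ (n * L) \<cdot>\<^sub>m map_mat (\<lambda>c. [:c:]) D)"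
      and "j < dim_col (poly_w ^ (n * L) \<cdot>\<^sub>m map_mat (\<lambda>c. [:c:]) D)"
    then have ij: "i < L" "j < L"
      by (simp_all add: D_def)
    then have "(mat_of_rows L (map (Q_tilde L Q) [0..<L]) * mat_of_cols L (map (P_tilde L P) [0..<L]))
        $$ (i, j) = S i j"
      by (simp add: S_def scalar_prod_def Q_tilde_def P_tilde_def lessThan_atLeast0)
    also have "S i j = poly_w ^ (n * L) * [:coeff (S i j) (n * L):]"
      by (subst S[OF ij]) (simp add: monom_power smult_monom)
    finally show "(mat_of_rows L (map (Q_tilde L Q) [0..<L]) * mat_of_cols L (map (P_tilde L P) [0..<L]))
        $$ (i, j) = (poly_w ^ (n * L) \<cdot>\<^sub>m map_mat (\<lambda>c. [:c:]) D) $$ (i, j)"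
      using ij by (simp add: D_def)
  qed (simp_all add: D_def)
  moreover have "D \<in> carrier_mat L L" "diagonal_mat D"
    using off_diag by (simp_all add: D_def diagonal_mat_def)
  ultimately show ?thesis
    by blast
qed

end
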